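(* Let $n,r$ be positive integers, let $F\subseteq\{c\in\mathbb{N}^r:0<|c|\le n\}$ index a subfamily of the basic family, and let $\Phi_F:=(b_c)_{c\in F}$. (i) If $F$ generates the semifield of $S_n$-invariant tropical rational functions on $\mathbb{R}^{n\times r}$, then $\Phi_F$ separates $S_n$-orbits. (ii) If $F$ contains all single-column indices $ie_\alpha$ ($i\in\{1,\dots,n\}$, $\alpha\in\{1,\dots,r\}$), i.e. the subfamily contains all $b_{ie_\alpha}$, and $\Phi_F$ separates $S_n$-orbits, then $F$ generates the semifield of $S_n$-invariant tropical rational functions on $\mathbb{R}^{n\times r}$. Hence, for subfamilies containing all single-column values, generating and separating are equivalent.
   Context: $\mathbb{N}=\{0,1,2,\dots\}$; $e_\alpha$ is the $\alpha$th standard basis vector of $\mathbb{N}^r$. The symmetric group $S_n$ acts on $\mathbb{R}^{n\times r}$ by permuting rows. For $M=(m_{i\alpha})\in\mathbb{R}^{n\times r}$ and $c\in\mathbb{N}^r$ with $0<|c|:=c_1+\cdots+c_r\le n$, the basic value is $$b_c(M)=\max\Bigl\{\sum_{\alpha=1}^r\sum_{i\in I_\alpha} m_{i\alpha} : I_1,\dots,I_r\subseteq\{1,\dots,n\}\text{ pairwise disjoint},\ \#I_\alpha=c_\alpha\Bigr\}.$$ $\Phi_F$ separates orbits if $\Phi_F(M)=\Phi_F(M')$ implies that $M,M'$ lie in the same $S_n$-orbit. A tropical polynomial on $\mathbb{R}^m$ is a finite maximum of functions $z\mapsto\gamma+\sum_i a_iz_i$ with $\gamma\in\mathbb{R}$,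 $a\in\mathbb{Z}_{\ge0}^m$; a tropical rational function is a difference of two tropical polynomials, regarded as a function. These form a semifield under $\max$ (addition), $+$ (multiplication), $-$ (division). The subfamily $F$ generates the semifield of invariant tropical rational functions if every $S_n$-invariant tropical rational $f$ on $\mathbb{R}^{n\times r}$ equals $g\circ\Phi_F$ for some tropical rational $g$ on $\mathbb{R}^{\#F}$. *)

theory Defs
  imports Complex_Main "HOL-Library.Cardinality" "HOL-Library.FuncSet" "HOL-Library.Disjoint_Sets"
begin

text \<open>
  The row set \<open>{1,\<dots>,n}\<close> and the column set \<open>{1,\<dots>,r}\<close> are finite types \<open>'n\<close> and \<open>'r\<close>
  (types are nonempty, so \<open>n, r \<ge> 1\<close>), and \<open>n\<close> is \<open>CARD('n)\<close>. For an index set \<open>I\<close>, a point of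
  \<open>\<real>\<^sup>I\<close> is a function \<open>z :: 'i \<Rightarrow> real\<close> of which only the values on \<open>I\<close> are used.
\<close>

definition tropical_polynomial :: "'i set \<Rightarrow> (('i \<Rightarrow> real) \<Rightarrow> real) \<Rightarrow> bool" where
  "tropical_polynomial I f \<longleftrightarrow>
     (\<exists>T :: (real \<times> ('i \<Rightarrow> nat)) set. finite T \<and> T \<noteq> {} \<and>
        f = (\<lambda>z. Max ((\<lambda>(\<gamma>, a). \<gamma> + (\<Sum>i\<in>I. real (a i) * z i)) ` T)))"

definition tropical_rational :: "'i set \<Rightarrow> (('i \<Rightarrow> real) \<Rightarrow> real) \<Rightarrow> bool" where
  "tropical_rational I f \<longleftrightarrow>
     (\<exists>p q. tropical_polynomial I p \<and> tropical_polynomial I q \<and> f = (\<lambda>z. p z - q z))"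

type_synonym ('n, 'r) matrix = "'n \<times> 'r \<Rightarrow> real"

definition permute_rows :: "('n \<Rightarrow> 'n) \<Rightarrow> ('n, 'r) matrix \<Rightarrow> ('n, 'r) matrix" where
  "permute_rows \<sigma> M = (\<lambda>(i, \<alpha>). M (inv \<sigma> i, \<alpha>))"

definition same_orbit :: "('n, 'r) matrix \<Rightarrow> ('n, 'r) matrix \<Rightarrow> bool" where
  "same_orbit M M' \<longleftrightarrow> (\<exists>\<sigma>. bij \<sigma> \<and> M' = permute_rows \<sigma> M)"

definition row_invariant :: "(('n, 'r) matrix \<Rightarrow> real) \<Rightarrow> bool" where
  "row_invariant f \<longleftrightarrow> (\<forall>\<sigma> M. bij \<sigma> \<longrightarrow> f (permute_rows \<sigma> M) = f M)"

definition basic_indices :: "'n::finite itself \<Rightarrow> ('r::finite \<Rightarrow> nat) set" where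
  "basic_indices _ = {c. 0 < (\<Sum>\<alpha>\<in>UNIV. c \<alpha>) \<and> (\<Sum>\<alpha>\<in>UNIV. c \<alpha>) \<le> CARD('n)}"

text \<open>
  The maximum is over a finite set, which is nonempty when \<open>c \<in> basic_indices TYPE('n)\<close>; for other
  \<open>c\<close> the value can be arbitrary and is never used.
\<close>
definition basic_value :: "('r::finite \<Rightarrow> nat) \<Rightarrow> ('n::finite, 'r) matrix \<Rightarrow> real" where
  "basic_value c M =
     Max {\<Sum>\<alpha>\<in>UNIV. \<Sum>i\<in>I \<alpha>. M (i, \<alpha>) | I :: 'r \<Rightarrow> 'n set.
            disjoint_family I \<and> (\<forall>\<alpha>. card (I \<alpha>) = c \<alpha>)}"

text \<open>Restricting to \<open>F\<close> makes equality of values of \<open>\<Phi>\<^sub>F\<close> mean equality of all \<open>b\<^sub>c\<close>, \<open>c \<in> F\<close>.\<close>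
definition basic_map ::
  "('r::finite \<Rightarrow> nat) set \<Rightarrow> ('n::finite, 'r) matrix \<Rightarrow> (('r \<Rightarrow> nat) \<Rightarrow> real)" where
  "basic_map F M = (\<lambda>c\<in>F. basic_value c M)"

definition separates_orbits :: "'n::finite itself \<Rightarrow> ('r::finite \<Rightarrow> nat) set \<Rightarrow> bool" where
  "separates_orbits _ F \<longleftrightarrow>
     (\<forall>M M' :: ('n, 'r) matrix. basic_map F M = basic_map F M' \<longrightarrow> same_orbit M M')"

definition generates_invariants :: "'n::finite itself \<Rightarrow> ('r::finite \<Rightarrow> nat) set \<Rightarrow> bool" where
  "generates_invariants _ F \<longleftrightarrow>
     (\<forall>f :: ('n, 'r) matrix \<Rightarrow> real. tropical_rational UNIV f \<and> row_invariant f \<longrightarrow>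
        (\<exists>g. tropical_rational F g \<and> f = g \<circ> basic_map F))"

definition std_basis :: "'r \<Rightarrow> 'r \<Rightarrow> nat" where
  "std_basis \<alpha> = (\<lambda>\<beta>. if \<beta> = \<alpha> then 1 else 0)"

definition single_column_indices :: "'n::finite itself \<Rightarrow> ('r \<Rightarrow> nat) set" where
  "single_column_indices _ = {(\<lambda>\<beta>. i * std_basis \<alpha> \<beta>) | i \<alpha>. i \<in> {1..CARD('n)}}"

end

theory Submission
  imports Defs "HOL-Analysis.Finite_Cartesian_Product"
begin

text \<open>
  Write \<open>\<Phi> = basic_map F\<close>. Tropical rational functions of finitely many variables are exactly the
  functions built from constants and coordinates by addition, negation and binary maximum
  (\<open>tropical_rational_iff_span\<close>). So absolute values, finite sums, finite maxima and minima, and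
  substitutions of tropical rational functions are again tropical rational, and a tropical rational
  function is recognised from the shape of a formula for it.

  Generating implies separating: the \<open>\<ell>\<^sup>1\<close> distance of \<open>Z\<close> to the orbit of \<open>M\<close> (\<open>orbit_dist Z M\<close>) is an
  invariant tropical rational function of \<open>Z\<close> that vanishes exactly on the orbit of \<open>M\<close>. If it
  factors through \<open>\<Phi>\<close>, then \<open>\<Phi> M' = \<Phi> M\<close> forces \<open>M'\<close> into that orbit.

  Separating implies generating: the value with index \<open>k e\<^sub>\<alpha>\<close> is the sum of the \<open>k\<close> largest entries
  of column \<open>\<alpha>\<close>, so an entry is the difference of two consecutive values once its rank in its column
  is known. A table \<open>\<tau>\<close> of ranks therefore defines an integral linear map \<open>L\<^sub>\<tau>\<close> with \<open>L\<^sub>\<tau> (\<Phi> M) = M\<close>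
  for every \<open>M\<close> whose ranks are \<open>\<tau>\<close>. The point \<open>y = \<Phi> M\<close> does not reveal the ranks of \<open>M\<close>, so all
  tables compete, and a table is fined for reconstructing a matrix with the wrong values:
  \<open>g y = min\<^sub>\<tau> (f (L\<^sub>\<tau> y) + K \<Sum>\<^sub>c \<bar>b\<^sub>c (L\<^sub>\<tau> y) - y\<^sub>c\<bar>)\<close>. The ranks of \<open>M\<close> contribute \<open>f M\<close> to
  \<open>g (\<Phi> M)\<close>, and nothing smaller occurs as soon as
  \<open>f M \<le> f W + K \<Sum>\<^sub>c \<bar>b\<^sub>c W - b\<^sub>c M\<bar>\<close> for all \<open>M\<close> and \<open>W\<close>.

  An invariant tropical rational \<open>f\<close> is Lipschitz for the orbit distance, so this inequality follows
  if the orbit distance of two matrices is at most a constant times the distance of their images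
  under \<open>\<Phi>\<close> (\<open>separates_imp_orbit_dist_le\<close>). Both quantities are homogeneous piecewise linear in the
  pair of matrices, and separation says that the first vanishes wherever the second does. On each
  of the finitely many cones on which both are linear, Farkas' lemma turns this implication into a
  linear inequality (\<open>piecewise_linear_error_bound\<close>).
\<close>

section \<open>The semifield generated by a set of functions\<close>

text \<open>
  The semifield operations are those of the tropical semifield: \<open>+\<close> is the multiplication, with the
  constant \<open>0\<close> as its unit, unary minus is the inversion and \<open>max\<close> is the addition. Over constants and
  coordinates the span consists of the tropical rational functions; over linear functionals it
  consists of homogeneous piecewise linear functions.
\<close>
inductive_set semifield_span :: "('x \<Rightarrow> real) set \<Rightarrow> ('x \<Rightarrow> real) set"
  for B :: "('x \<Rightarrow> real) set" where
  zero: "(\<lambda>_. 0) \<in> semifield_span B"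
| base: "f \<in> B \<Longrightarrow> f \<in> semifield_span B"
| plus: "f \<in> semifield_span B \<Longrightarrow> g \<in> semifield_span B \<Longrightarrow> (\<lambda>x. f x + g x) \<in> semifield_span B"
| uminus: "f \<in> semifield_span B \<Longrightarrow> (\<lambda>x. - f x) \<in> semifield_span B"
| max: "f \<in> semifield_span B \<Longrightarrow> g \<in> semifield_span B \<Longrightarrow> (\<lambda>x. max (f x) (g x)) \<in> semifield_span B"

lemma span_minus:
  assumes "f \<in> semifield_span B" "g \<in> semifield_span B"
  shows "(\<lambda>x. f x - g x) \<in> semifield_span B"
  using semifield_span.plus[OF assms(1) semifield_span.uminus[OF assms(2)]] by simp

lemma span_abs:
  assumes "f \<in> semifield_span B"
  shows "(\<lambda>x. \<bar>f x\<bar>) \<in> semifield_span B"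
proof -
  have "(\<lambda>x. max (f x) (- f x)) \<in> semifield_span B"
    by (intro semifield_span.max semifield_span.uminus assms)
  moreover have "(\<lambda>x. max (f x) (- f x)) = (\<lambda>x. \<bar>f x\<bar>)" by (auto simp: fun_eq_iff)
  ultimately show ?thesis by simp
qed

lemma span_sum:
  assumes "\<And>s. s \<in> S \<Longrightarrow> h s \<in> semifield_span B"
  shows "(\<lambda>x. \<Sum>s\<in>S. h s x) \<in> semifield_span B"
proof (cases "finite S")
  case True
  then show ?thesis using assms
    by (induction S) (auto intro: semifield_span.zero semifield_span.plus)
qed (simp add: semifield_span.zero)

lemma span_of_nat_mult:
  assumes "f \<in> semifield_span B"
  shows "(\<lambda>x. real k * f x) \<in> semifield_span B"
  using span_sum[of "{..<k}" "\<lambda>_. f" B] assms by simp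

lemma span_Max:
  assumes "finite S" "S \<noteq> {}" "\<And>s. s \<in> S \<Longrightarrow> h s \<in> semifield_span B"
  shows "(\<lambda>x. Max ((\<lambda>s. h s x) ` S)) \<in> semifield_span B"
  using assms
proof (induction S rule: finite_ne_induct)
  case (insert s S)
  then show ?case using semifield_span.max[of "h s" B] by simp
qed simp

lemma Min_image_eq_uminus_Max:
  fixes h :: "'s \<Rightarrow> real"
  assumes "finite S" "S \<noteq> {}"
  shows "Min (h ` S) = - Max ((\<lambda>s. - h s) ` S)"
proof (rule Min_eqI)
  fix y assume "y \<in> h ` S"
  then obtain s where s: "s \<in> S" "y = h s" by auto
  then have "- h s \<le> Max ((\<lambda>s. - h s) ` S)" using assms by (intro Max_ge) auto
  then show "- Max ((\<lambda>s. - h s) ` S) \<le> y" using s by simp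
next
  have "Max ((\<lambda>s. - h s) ` S) \<in> (\<lambda>s. - h s) ` S" using assms by (intro Max_in) auto
  then show "- Max ((\<lambda>s. - h s) ` S) \<in> h ` S" by auto
qed (use assms in auto)

lemma span_Min:
  assumes "finite S" "S \<noteq> {}" "\<And>s. s \<in> S \<Longrightarrow> h s \<in> semifield_span B"
  shows "(\<lambda>x. Min ((\<lambda>s. h s x) ` S)) \<in> semifield_span B"
  unfolding Min_image_eq_uminus_Max[OF assms(1,2)]
  by (intro semifield_span.uminus span_Max assms)

lemma span_substitute:
  assumes "h \<in> semifield_span B"
    and "\<And>f. f \<in> B \<Longrightarrow> (\<lambda>y. f (\<psi> y)) \<in> semifield_span B'"
  shows "(\<lambda>y. h (\<psi> y)) \<in> semifield_span B'"
  using assms(1) by induction (auto intro: semifield_span.intros assms(2))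

section \<open>Tropical rational functions\<close>

definition coordinates :: "'i set \<Rightarrow> (('i \<Rightarrow> real) \<Rightarrow> real) set" where
  "coordinates I = (\<lambda>i z. z i) ` I"

lemma Max_plus_Max:
  fixes f :: "'a \<Rightarrow> real" and g :: "'b \<Rightarrow> real"
  assumes "finite S" "S \<noteq> {}" "finite T" "T \<noteq> {}"
  shows "Max ((\<lambda>(s, t). f s + g t) ` (S \<times> T)) = Max (f ` S) + Max (g ` T)"
proof (rule Max_eqI)
  fix y assume "y \<in> (\<lambda>(s, t). f s + g t) ` (S \<times> T)"
  then show "y \<le> Max (f ` S) + Max (g ` T)" using assms by (auto intro!: add_mono Max_ge)
next
  have "Max (f ` S) \<in> f ` S" "Max (g ` T) \<in> g ` T" using assms by (auto intro!: Max_in)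
  then show "Max (f ` S) + Max (g ` T) \<in> (\<lambda>(s, t). f s + g t) ` (S \<times> T)" by force
qed (use assms in auto)

text \<open>
  Addition distributes over \<open>max\<close>, so the product is the maximum over all pairs of monomials, one from
  each factor; coefficients and exponents of a pair add up.
\<close>
lemma tropical_polynomial_plus:
  assumes "tropical_polynomial I p" "tropical_polynomial I q"
  shows "tropical_polynomial I (\<lambda>z. p z + q z)"
proof -
  define m where "m z = (\<lambda>(\<gamma>, a). \<gamma> + (\<Sum>i\<in>I. real (a i) * z i))" for z :: "'a \<Rightarrow> real"
  obtain S T where S: "finite S" "S \<noteq> {}" "p = (\<lambda>z. Max (m z ` S))"
    and T: "finite T" "T \<noteq> {}" "q = (\<lambda>z. Max (m z ` T))"
    using assms unfolding tropical_polynomial_def m_def by blast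
  let ?U = "(\<lambda>((\<gamma>, a), (\<delta>, b)). (\<gamma> + \<delta>, \<lambda>i. a i + b i)) ` (S \<times> T)"
  have "p z + q z = Max (m z ` ?U)" for z
  proof -
    have "m z ` ?U = (\<lambda>(s, t). m z s + m z t) ` (S \<times> T)"
      unfolding image_image
      by (rule image_cong) (auto simp: m_def algebra_simps sum.distrib)
    then show ?thesis using S T by (simp add: Max_plus_Max)
  qed
  moreover have "finite ?U" "?U \<noteq> {}" using S T by auto
  ultimately show ?thesis unfolding tropical_polynomial_def m_def by blast
qed

lemma tropical_polynomial_max:
  assumes "tropical_polynomial I p" "tropical_polynomial I q"
  shows "tropical_polynomial I (\<lambda>z. max (p z) (q z))"
proof -
  define m where "m z = (\<lambda>(\<gamma>, a). \<gamma> + (\<Sum>i\<in>I. real (a i) * z i))" for z :: "'a \<Rightarrow> real"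
  obtain S T where S: "finite S" "S \<noteq> {}" "p = (\<lambda>z. Max (m z ` S))"
    and T: "finite T" "T \<noteq> {}" "q = (\<lambda>z. Max (m z ` T))"
    using assms unfolding tropical_polynomial_def m_def by blast
  have "max (p z) (q z) = Max (m z ` (S \<union> T))" for z
    using S T by (simp add: image_Un Max_Un)
  moreover have "finite (S \<union> T)" "S \<union> T \<noteq> {}" using S T by auto
  ultimately show ?thesis unfolding tropical_polynomial_def m_def by blast
qed

lemma tropical_polynomial_const: "tropical_polynomial I (\<lambda>_. \<gamma>)"
  unfolding tropical_polynomial_def by (intro exI[of _ "{(\<gamma>, \<lambda>_. 0)}"]) simp

lemma tropical_polynomial_coordinate:
  assumes "finite I" "i \<in> I"
  shows "tropical_polynomial I (\<lambda>z. z i)"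
proof -
  have "(\<Sum>j\<in>I. real (if j = i then 1 else 0) * z j) = z i" for z :: "'a \<Rightarrow> real"
    using assms by (simp add: if_distrib[of real] if_distrib[of "\<lambda>t. t * _"] cong: if_cong)
  then show ?thesis
    unfolding tropical_polynomial_def by (intro exI[of _ "{(0, \<lambda>j. if j = i then 1 else 0)}"]) simp
qed

lemma tropical_polynomial_in_span:
  assumes "tropical_polynomial I p"
  shows "p \<in> semifield_span (range (\<lambda>\<gamma> _. \<gamma>) \<union> coordinates I)"
proof -
  obtain T where T: "finite T" "T \<noteq> {}"
    "p = (\<lambda>z. Max ((\<lambda>(\<gamma>, a). \<gamma> + (\<Sum>i\<in>I. real (a i) * z i)) ` T))"
    using assms unfolding tropical_polynomial_def by blast
  show ?thesis
    unfolding T(3) case_prod_beta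
    by (intro span_Max T semifield_span.plus span_sum span_of_nat_mult)
      (auto intro!: semifield_span.base simp: coordinates_def)
qed

text \<open>
  Differences of tropical polynomials are closed under \<open>max\<close> because of the common denominator
  \<open>max (p - q) (p' - q') = max (p + q') (p' + q) - (q + q')\<close>. Finiteness of \<open>I\<close> makes the coordinates
  tropical polynomials: a sum over an infinite index set is \<open>0\<close> by default.
\<close>
lemma tropical_rational_iff_span:
  assumes "finite I"
  shows "tropical_rational I f \<longleftrightarrow> f \<in> semifield_span (range (\<lambda>\<gamma> _. \<gamma>) \<union> coordinates I)"
proof
  assume "tropical_rational I f"
  then show "f \<in> semifield_span (range (\<lambda>\<gamma> _. \<gamma>) \<union> coordinates I)"
    unfolding tropical_rational_def by (auto intro: span_minus tropical_polynomial_in_span)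
next
  have poly: "tropical_rational I p" if "tropical_polynomial I p" for p
    unfolding tropical_rational_def using that tropical_polynomial_const[of I 0]
    by (intro exI[of _ p] exI[of _ "\<lambda>_. 0"]) auto
  assume "f \<in> semifield_span (range (\<lambda>\<gamma> _. \<gamma>) \<union> coordinates I)"
  then show "tropical_rational I f"
  proof induction
    case zero
    show ?case by (intro poly tropical_polynomial_const)
  next
    case (base f)
    then show ?case
      by (auto simp: coordinates_def
          intro!: poly tropical_polynomial_const tropical_polynomial_coordinate assms)
  next
    case (plus f g)
    then obtain p q p' q' where *: "tropical_polynomial I p" "tropical_polynomial I q"
      "tropical_polynomial I p'" "tropical_polynomial I q'"
      "f = (\<lambda>z. p z - q z)" "g = (\<lambda>z. p' z - q' z)"
      unfolding tropical_rational_def by blast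
    show ?case unfolding tropical_rational_def
      by (intro exI[of _ "\<lambda>z. p z + p' z"] exI[of _ "\<lambda>z. q z + q' z"])
        (simp add: * tropical_polynomial_plus fun_eq_iff)
  next
    case (uminus f)
    then obtain p q where "tropical_polynomial I p" "tropical_polynomial I q"
      "f = (\<lambda>z. p z - q z)"
      unfolding tropical_rational_def by blast
    then show ?case unfolding tropical_rational_def
      by (intro exI[of _ q] exI[of _ p]) simp
  next
    case (max f g)
    then obtain p q p' q' where *: "tropical_polynomial I p" "tropical_polynomial I q"
      "tropical_polynomial I p'" "tropical_polynomial I q'"
      "f = (\<lambda>z. p z - q z)" "g = (\<lambda>z. p' z - q' z)"
      unfolding tropical_rational_def by blast
    have "max (f z) (g z) = max (p z + q' z) (p' z + q z) - (q z + q' z)" for z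
      by (simp add: * max_def)
    then show ?case unfolding tropical_rational_def
      by (intro exI[of _ "\<lambda>z. max (p z + q' z) (p' z + q z)"] exI[of _ "\<lambda>z. q z + q' z"])
        (auto simp: * fun_eq_iff intro!: tropical_polynomial_plus tropical_polynomial_max)
  qed
qed

lemma span_affine_coordinates_Lipschitz:
  fixes f :: "('i::finite \<Rightarrow> real) \<Rightarrow> real"
  assumes "f \<in> semifield_span (range (\<lambda>\<gamma> _. \<gamma>) \<union> coordinates UNIV)"
  shows "\<exists>K\<ge>0. \<forall>x y. \<bar>f x - f y\<bar> \<le> K * (\<Sum>i\<in>UNIV. \<bar>x i - y i\<bar>)"
  using assms
proof induction
  case (base f)
  then consider \<gamma> where "f = (\<lambda>_. \<gamma>)" | i where "f = (\<lambda>z. z i)"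
    by (auto simp: coordinates_def)
  then show ?case
  proof cases
    case (2 i)
    have "\<bar>x i - y i\<bar> \<le> (\<Sum>j\<in>UNIV. \<bar>x j - y j\<bar>)" for x y :: "'i \<Rightarrow> real"
      by (intro member_le_sum) auto
    with 2 show ?thesis by (intro exI[of _ 1]) simp
  qed (auto intro: exI[of _ 0])
next
  case (plus f g)
  then obtain K L where K: "K \<ge> 0" "L \<ge> 0"
    "\<And>x y. \<bar>f x - f y\<bar> \<le> K * (\<Sum>i\<in>UNIV. \<bar>x i - y i\<bar>)"
    "\<And>x y. \<bar>g x - g y\<bar> \<le> L * (\<Sum>i\<in>UNIV. \<bar>x i - y i\<bar>)" by blast
  have "\<bar>f x + g x - (f y + g y)\<bar> \<le> (K + L) * (\<Sum>i\<in>UNIV. \<bar>x i - y i\<bar>)" for x y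
    using K(3,4)[of x y] unfolding distrib_right by linarith
  then show ?case using K by (intro exI[of _ "K + L"]) auto
next
  case (max f g)
  then obtain K L where K: "K \<ge> 0" "L \<ge> 0"
    "\<And>x y. \<bar>f x - f y\<bar> \<le> K * (\<Sum>i\<in>UNIV. \<bar>x i - y i\<bar>)"
    "\<And>x y. \<bar>g x - g y\<bar> \<le> L * (\<Sum>i\<in>UNIV. \<bar>x i - y i\<bar>)" by blast
  have "\<bar>max (f x) (g x) - max (f y) (g y)\<bar> \<le> (K + L) * (\<Sum>i\<in>UNIV. \<bar>x i - y i\<bar>)" for x y
  proof -
    have "0 \<le> K * (\<Sum>i\<in>UNIV. \<bar>x i - y i\<bar>)" "0 \<le> L * (\<Sum>i\<in>UNIV. \<bar>x i - y i\<bar>)"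
      using K by (auto intro!: mult_nonneg_nonneg sum_nonneg)
    then show ?thesis using K(3,4)[of x y] unfolding distrib_right by linarith
  qed
  then show ?case using K by (intro exI[of _ "K + L"]) auto
qed (auto intro: exI[of _ 0] simp: abs_minus_commute)

section \<open>Piecewise linear functions and Farkas' lemma\<close>

text \<open>
  A linear functional that is nonpositive wherever finitely many others are is a nonnegative
  combination of them. The induction on the number of constraints is Bartl's algebraic proof. If
  \<open>j\<close> cannot be dropped, some vector satisfies all other constraints but has \<open>b > 0\<close>, hence violates
  \<open>j\<close>; projecting along this vector onto the kernel of \<open>a j\<close> removes the constraint, and the signs
  at the vector make the coefficient of \<open>a j\<close> in the resulting combination nonnegative.
\<close>
lemma farkas:
  fixes a :: "'k \<Rightarrow> 'v::real_vector \<Rightarrow> real"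
  assumes "finite K" "\<And>k. k \<in> K \<Longrightarrow> linear (a k)" "linear b"
    and "\<And>x. (\<And>k. k \<in> K \<Longrightarrow> a k x \<le> 0) \<Longrightarrow> b x \<le> 0"
  shows "\<exists>w. (\<forall>k\<in>K. 0 \<le> w k) \<and> (\<forall>x. b x = (\<Sum>k\<in>K. w k * a k x))"
  using assms
proof (induction K arbitrary: a b rule: finite_induct)
  case empty
  have "b x = 0" for x
    using empty.prems(3)[of x] empty.prems(3)[of "- x"] linear_neg[OF empty.prems(2), of x] by simp
  then show ?case by simp
next
  case (insert j K)
  have lin: "linear (a k)" if "k \<in> insert j K" for k using insert.prems(1) that by blast
  show ?case
  proof (cases "\<forall>x. (\<forall>k\<in>K. a k x \<le> 0) \<longrightarrow> b x \<le> 0")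
    case True
    then obtain w where w: "\<forall>k\<in>K. 0 \<le> w k" "\<forall>x. b x = (\<Sum>k\<in>K. w k * a k x)"
      using insert.IH[of a b] insert.prems by blast
    have "(\<Sum>k\<in>K. (w(j := 0)) k * a k x) = (\<Sum>k\<in>K. w k * a k x)" for x
      using insert.hyps by (intro sum.cong) auto
    then show ?thesis using w insert.hyps by (intro exI[of _ "w(j := 0)"]) simp
  next
    case False
    then obtain u where u: "\<And>k. k \<in> K \<Longrightarrow> a k u \<le> 0" "b u > 0" by force
    have "a j u > 0" using u insert.prems(3)[of u] by force
    define x0 where "x0 = u /\<^sub>R a j u"
    have x0: "a j x0 = 1" "b x0 > 0" "\<And>k. k \<in> K \<Longrightarrow> a k x0 \<le> 0"
      using u \<open>a j u > 0\<close> lin insert.prems(2)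
      by (auto simp: x0_def linear_scale zero_less_mult_iff mult_le_0_iff)
    \<comment> \<open>Composing with the projection \<open>x \<mapsto> x - a j x \<cdot> x0\<close> onto the kernel of \<open>a j\<close>
      removes the constraint \<open>j\<close>.\<close>
    have proj: "c (x - a j x *\<^sub>R x0) = c x - a j x * c x0" if "linear c" for c :: "'v \<Rightarrow> real" and x
      using that by (simp add: linear_diff linear_scale)
    have "\<exists>w. (\<forall>k\<in>K. 0 \<le> w k) \<and>
        (\<forall>x. b (x - a j x *\<^sub>R x0) = (\<Sum>k\<in>K. w k * a k (x - a j x *\<^sub>R x0)))"
    proof (rule insert.IH)
      have P: "linear (\<lambda>x. x - a j x *\<^sub>R x0)"
        using lin[of j] by (intro linearI) (simp_all add: linear_add linear_scale algebra_simps)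
      show "linear (\<lambda>x. a k (x - a j x *\<^sub>R x0))" if "k \<in> K" for k
        using linear_compose[OF P lin[of k]] that by (simp add: o_def)
      show "linear (\<lambda>x. b (x - a j x *\<^sub>R x0))"
        using linear_compose[OF P insert.prems(2)] by (simp add: o_def)
      show "b (x - a j x *\<^sub>R x0) \<le> 0" if "\<And>k. k \<in> K \<Longrightarrow> a k (x - a j x *\<^sub>R x0) \<le> 0" for x
        using that x0(1) proj[OF lin[of j]] by (intro insert.prems(3)) auto
    qed
    then obtain w where w: "\<forall>k\<in>K. 0 \<le> w k"
      "\<And>x. b (x - a j x *\<^sub>R x0) = (\<Sum>k\<in>K. w k * a k (x - a j x *\<^sub>R x0))" by blast
    define w' where "w' = w(j := b x0 - (\<Sum>k\<in>K. w k * a k x0))"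
    have "(\<Sum>k\<in>K. w k * a k x0) \<le> 0"
      using w(1) x0(3) by (intro sum_nonpos mult_nonneg_nonpos) auto
    then have "\<forall>k\<in>insert j K. 0 \<le> w' k" using w(1) x0(2) by (auto simp: w'_def)
    moreover have "b x = (\<Sum>k\<in>insert j K. w' k * a k x)" for x
    proof -
      have "b x = a j x * b x0 + (\<Sum>k\<in>K. w k * (a k x - a j x * a k x0))"
        using w(2)[of x] proj[OF insert.prems(2), of x] proj[OF lin] by (simp cong: sum.cong)
      also have "\<dots> = (b x0 - (\<Sum>k\<in>K. w k * a k x0)) * a j x + (\<Sum>k\<in>K. w k * a k x)"
        by (simp add: algebra_simps sum_subtractf sum_distrib_left sum_distrib_right)
      also have "(\<Sum>k\<in>K. w k * a k x) = (\<Sum>k\<in>K. w' k * a k x)"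
        using insert.hyps by (intro sum.cong) (auto simp: w'_def)
      finally show ?thesis using insert.hyps by (simp add: w'_def)
    qed
    ultimately show ?thesis by blast
  qed
qed

text \<open>
  Instead of listing the cones of a fan, a finite set \<open>A\<close> of functionals describes them: the cone of
  a point \<open>x\<close> consists of all points that satisfy every constraint \<open>a \<le> 0\<close>, \<open>a \<in> A\<close>, satisfied by
  \<open>x\<close>. Every point then lies in its own cone, and refining a fan is taking the union of two such
  sets. Finiteness of the set \<open>L\<close> of linear pieces makes it possible to compare two piecewise linear
  functions by adding finitely many functionals to \<open>A\<close>.
\<close>
definition linear_on_sign_cells ::
  "('v::real_vector \<Rightarrow> real) set \<Rightarrow> ('v \<Rightarrow> real) set \<Rightarrow> ('v \<Rightarrow> real) \<Rightarrow> bool" where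
  "linear_on_sign_cells A L h \<longleftrightarrow>
     finite A \<and> finite L \<and> (\<forall>a\<in>A. linear a) \<and> (\<forall>l\<in>L. linear l) \<and>
     (\<forall>x. \<exists>l\<in>L. \<forall>y. (\<forall>a\<in>A. a x \<le> 0 \<longrightarrow> a y \<le> 0) \<longrightarrow> h y = l y)"

lemma linear_on_sign_cellsD:
  assumes "linear_on_sign_cells A L h"
  shows "finite A" "finite L" "\<forall>a\<in>A. linear a" "\<forall>l\<in>L. linear l"
    and "\<exists>l\<in>L. \<forall>y. (\<forall>a\<in>A. a x \<le> 0 \<longrightarrow> a y \<le> 0) \<longrightarrow> h y = l y"
  using assms unfolding linear_on_sign_cells_def by simp_all

lemma span_linear_is_piecewise_linear:
  fixes h :: "'v::real_vector \<Rightarrow> real"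
  assumes "h \<in> semifield_span {l. linear l}"
  shows "\<exists>A L. linear_on_sign_cells A L h"
  using assms
proof induction
  case zero
  show ?case
    by (intro exI[of _ "{}"] exI[of _ "{\<lambda>_. 0}"])
      (auto simp: linear_on_sign_cells_def intro!: linearI)
next
  case (base f)
  then show ?case
    by (intro exI[of _ "{}"] exI[of _ "{f}"]) (auto simp: linear_on_sign_cells_def)
next
  case (plus f g)
  then obtain A L A' L' where cells: "linear_on_sign_cells A L f" "linear_on_sign_cells A' L' g"
    by blast
  note * = linear_on_sign_cellsD[OF cells(1)] linear_on_sign_cellsD[OF cells(2)]
  let ?L = "(\<lambda>(l, l') x. l x + l' x) ` (L \<times> L')"
  have "\<exists>l\<in>?L. \<forall>y. (\<forall>a\<in>A \<union> A'. a x \<le> 0 \<longrightarrow> a y \<le> 0) \<longrightarrow> f y + g y = l y" for x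
    using *(5)[of x] *(10)[of x] by fastforce
  moreover have "finite (A \<union> A')" "finite ?L" "\<forall>a\<in>A \<union> A'. linear a" "\<forall>l\<in>?L. linear l"
    using * by (auto intro: linear_compose_add)
  ultimately show ?case unfolding linear_on_sign_cells_def by blast
next
  case (uminus f)
  then obtain A L where cells: "linear_on_sign_cells A L f" by blast
  note * = linear_on_sign_cellsD[OF cells]
  let ?L = "(\<lambda>l x. - l x) ` L"
  have "\<exists>l\<in>?L. \<forall>y. (\<forall>a\<in>A. a x \<le> 0 \<longrightarrow> a y \<le> 0) \<longrightarrow> - f y = l y" for x
    using *(5)[of x] by fastforce
  moreover have "finite ?L" "\<forall>l\<in>?L. linear l"
    using * by (auto intro: linear_compose_neg)
  ultimately show ?case using *(1,3) unfolding linear_on_sign_cells_def by blast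
next
  case (max f g)
  then obtain A L A' L' where cells: "linear_on_sign_cells A L f" "linear_on_sign_cells A' L' g"
    by blast
  note * = linear_on_sign_cellsD[OF cells(1)] linear_on_sign_cellsD[OF cells(2)]
  \<comment> \<open>The differences of linear pieces decide which of the two attains the maximum.\<close>
  define C where "C = A \<union> A' \<union> (\<lambda>(l, l') x. l x - l' x) ` (L \<times> L')
    \<union> (\<lambda>(l, l') x. l' x - l x) ` (L \<times> L')"
  have "\<exists>l\<in>L \<union> L'. \<forall>y. (\<forall>a\<in>C. a x \<le> 0 \<longrightarrow> a y \<le> 0) \<longrightarrow> max (f y) (g y) = l y" for x
  proof -
    obtain l l' where l: "l \<in> L" "\<And>y. (\<forall>a\<in>A. a x \<le> 0 \<longrightarrow> a y \<le> 0) \<Longrightarrow> f y = l y"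
      and l': "l' \<in> L'" "\<And>y. (\<forall>a\<in>A'. a x \<le> 0 \<longrightarrow> a y \<le> 0) \<Longrightarrow> g y = l' y"
      using *(5)[of x] *(10)[of x] by blast
    have C: "(\<lambda>x. l x - l' x) \<in> C" "(\<lambda>x. l' x - l x) \<in> C"
      using l(1) l'(1) by (force simp: C_def)+
    show ?thesis
    proof (cases "l' x \<le> l x")
      case True
      have "max (f y) (g y) = l y" if y: "\<forall>a\<in>C. a x \<le> 0 \<longrightarrow> a y \<le> 0" for y
        using l(2)[of y] l'(2)[of y] y bspec[OF y C(2)] True by (auto simp: C_def)
      then show ?thesis using l(1) by blast
    next
      case False
      have "max (f y) (g y) = l' y" if y: "\<forall>a\<in>C. a x \<le> 0 \<longrightarrow> a y \<le> 0" for y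
        using l(2)[of y] l'(2)[of y] y bspec[OF y C(1)] False by (auto simp: C_def)
      then show ?thesis using l'(1) by blast
    qed
  qed
  moreover have "finite C" "\<forall>a\<in>C. linear a"
    using * by (auto simp: C_def intro: linear_compose_sub)
  moreover have "finite (L \<union> L')" "\<forall>l\<in>L \<union> L'. linear l" using * by auto
  ultimately show ?case unfolding linear_on_sign_cells_def by blast
qed

text \<open>
  On the cone \<open>S \<le> 0\<close> of a point, \<open>D\<close> and \<open>E\<close> agree with functionals \<open>d\<close> and \<open>e\<close>. The hypotheses say
  that \<open>S \<le> 0\<close> and \<open>e \<le> 0\<close> imply \<open>d \<le> 0\<close>, so \<open>d\<close> is a nonnegative combination of \<open>S\<close> and \<open>e\<close> by Farkas'
  lemma. The constraints in \<open>S\<close> contribute nonpositive terms on the cone, and the coefficient of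
  \<open>e\<close> is a constant \<open>C\<close> valid there. Homogeneity is essential: \<open>E x = min \<bar>x\<bar> 1\<close> and \<open>D x = \<bar>x\<bar>\<close>
  have the same zeros but admit no constant.
\<close>
lemma piecewise_linear_error_bound:
  fixes D E :: "'v::real_vector \<Rightarrow> real"
  assumes "D \<in> semifield_span {l. linear l}" "E \<in> semifield_span {l. linear l}"
    and nonneg: "\<And>x. 0 \<le> E x" and zero: "\<And>x. E x = 0 \<Longrightarrow> D x \<le> 0"
  shows "\<exists>C\<ge>0. \<forall>x. D x \<le> C * E x"
proof -
  obtain A L A' L' where cells: "linear_on_sign_cells A L D" "linear_on_sign_cells A' L' E"
    using assms(1,2) span_linear_is_piecewise_linear by blast
  note * = linear_on_sign_cellsD[OF cells(1)] linear_on_sign_cellsD[OF cells(2)]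
  \<comment> \<open>The constant found for a point depends only on its cone and on the two linear pieces, which
    range over the finite set \<open>Q\<close>; the sum of all constants serves every point.\<close>
  define Q where "Q = Pow (A \<union> A') \<times> L \<times> L'"
  define bound where "bound q c \<longleftrightarrow> 0 \<le> c \<and>
    (\<forall>y. (\<forall>a\<in>fst q. a y \<le> 0) \<longrightarrow> fst (snd q) y \<le> c * snd (snd q) y)"
    for q :: "('v \<Rightarrow> real) set \<times> ('v \<Rightarrow> real) \<times> ('v \<Rightarrow> real)" and c
  define c where "c q = (if \<exists>t. bound q t then SOME t. bound q t else 0)" for q
  have c: "bound q (c q)" if "bound q t" for q t
    using that unfolding c_def by (auto intro: someI)
  have c_nonneg: "0 \<le> c q" for q
    using c[of q] by (cases "\<exists>t. bound q t") (auto simp: bound_def c_def)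
  have "finite Q" using * by (simp add: Q_def)
  have "D x \<le> (\<Sum>q\<in>Q. c q) * E x" for x
  proof -
    define S where "S = {a \<in> A \<union> A'. a x \<le> 0}"
    obtain d e where d: "d \<in> L" "\<And>y. \<forall>a\<in>S. a y \<le> 0 \<Longrightarrow> D y = d y"
      and e: "e \<in> L'" "\<And>y. \<forall>a\<in>S. a y \<le> 0 \<Longrightarrow> E y = e y"
      using *(5)[of x] *(10)[of x] unfolding S_def by blast
    have "finite (insert e S)" using * by (simp add: S_def)
    moreover have "linear k" if "k \<in> insert e S" for k using that * e by (auto simp: S_def)
    moreover have "linear d" using d * by blast
    moreover have "d y \<le> 0" if y: "\<And>k. k \<in> insert e S \<Longrightarrow> k y \<le> 0" for y
      using d(2)[of y] e(2)[of y] y nonneg[of y] zero[of y] by force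
    ultimately obtain w where w: "\<forall>k\<in>insert e S. 0 \<le> w k"
      "\<forall>y. d y = (\<Sum>k\<in>insert e S. w k * k y)"
      using farkas[of "insert e S" "\<lambda>k. k" d] by blast
    \<comment> \<open>The functional \<open>e\<close> may itself belong to \<open>S\<close>, so it is split off before the estimate.\<close>
    have "d y \<le> w e * e y" if y: "\<forall>a\<in>S. a y \<le> 0" for y
    proof -
      have "d y = w e * e y + (\<Sum>k\<in>S - {e}. w k * k y)"
        using w(2) \<open>finite (insert e S)\<close> by (simp add: sum.insert_remove)
      moreover have "(\<Sum>k\<in>S - {e}. w k * k y) \<le> 0"
        using w(1) y by (intro sum_nonpos mult_nonneg_nonpos) auto
      ultimately show ?thesis by simp
    qed
    then have "bound (S, d, e) (w e)" using w(1) by (simp add: bound_def)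
    then have b: "bound (S, d, e) (c (S, d, e))" by (rule c)
    have x: "\<forall>a\<in>S. a x \<le> 0" by (simp add: S_def)
    have "D x \<le> c (S, d, e) * E x"
      using b x d(2)[OF x] e(2)[OF x] by (simp add: bound_def)
    also have "\<dots> \<le> (\<Sum>q\<in>Q. c q) * E x"
      using d(1) e(1) \<open>finite Q\<close> c_nonneg nonneg[of x]
      by (intro mult_right_mono member_le_sum) (auto simp: Q_def S_def)
    finally show ?thesis .
  qed
  moreover have "0 \<le> (\<Sum>q\<in>Q. c q)" by (intro sum_nonneg c_nonneg)
  ultimately show ?thesis by blast
qed

section \<open>The orbit distance\<close>

definition orbit_dist :: "('n::finite, 'r::finite) matrix \<Rightarrow> ('n, 'r) matrix \<Rightarrow> real" where
  "orbit_dist Z M = Min ((\<lambda>\<sigma>. \<Sum>p\<in>UNIV. \<bar>Z p - permute_rows \<sigma> M p\<bar>) ` {\<sigma>. bij \<sigma>})"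

lemma permutations_nonempty: "{\<sigma> :: 'n \<Rightarrow> 'n. bij \<sigma>} \<noteq> {}"
  using bij_id by blast

lemma orbit_dist_attained:
  obtains \<sigma> where "bij \<sigma>" "orbit_dist Z M = (\<Sum>p\<in>UNIV. \<bar>Z p - permute_rows \<sigma> M p\<bar>)"
proof -
  have "orbit_dist Z M \<in> (\<lambda>\<sigma>. \<Sum>p\<in>UNIV. \<bar>Z p - permute_rows \<sigma> M p\<bar>) ` {\<sigma>. bij \<sigma>}"
    unfolding orbit_dist_def using permutations_nonempty by (intro Min_in) auto
  then show ?thesis using that by auto
qed

lemma orbit_dist_le:
  assumes "bij \<sigma>"
  shows "orbit_dist Z M \<le> (\<Sum>p\<in>UNIV. \<bar>Z p - permute_rows \<sigma> M p\<bar>)"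
  unfolding orbit_dist_def using assms by (intro Min_le) auto

lemma orbit_dist_nonneg: "0 \<le> orbit_dist Z M"
  by (rule orbit_dist_attained[of Z M]) (simp add: sum_nonneg)

lemma orbit_dist_eq_0_iff: "orbit_dist Z M = 0 \<longleftrightarrow> same_orbit M Z"
proof
  assume "orbit_dist Z M = 0"
  then obtain \<sigma> where "bij \<sigma>" "(\<Sum>p\<in>UNIV. \<bar>Z p - permute_rows \<sigma> M p\<bar>) = 0"
    by (metis orbit_dist_attained)
  then have "Z = permute_rows \<sigma> M" by (auto simp: sum_nonneg_eq_0_iff fun_eq_iff)
  with \<open>bij \<sigma>\<close> show "same_orbit M Z" by (auto simp: same_orbit_def)
next
  assume "same_orbit M Z"
  then obtain \<sigma> where "bij \<sigma>" "Z = permute_rows \<sigma> M" by (auto simp: same_orbit_def)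
  then show "orbit_dist Z M = 0" using orbit_dist_le[of \<sigma> Z M] orbit_dist_nonneg[of Z M] by simp
qed

text \<open>
  A permutation of \<open>Z\<close> can be absorbed in the permutation of \<open>M\<close> over which the minimum is taken.
  The reverse inequality is the same statement for the inverse permutation.
\<close>
lemma orbit_dist_permute_le:
  fixes Z M :: "('n::finite, 'r::finite) matrix"
  assumes "bij \<tau>"
  shows "orbit_dist (permute_rows \<tau> Z) M \<le> orbit_dist Z M"
proof -
  obtain \<sigma> where \<sigma>: "bij \<sigma>" "orbit_dist Z M = (\<Sum>p\<in>UNIV. \<bar>Z p - permute_rows \<sigma> M p\<bar>)"
    by (rule orbit_dist_attained)
  have "orbit_dist (permute_rows \<tau> Z) M \<le>
      (\<Sum>p\<in>UNIV. \<bar>permute_rows \<tau> Z p - permute_rows (\<tau> \<circ> \<sigma>) M p\<bar>)"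
    using assms \<sigma>(1) by (intro orbit_dist_le bij_comp)
  also have "\<dots> = (\<Sum>p\<in>UNIV. \<bar>Z p - permute_rows \<sigma> M p\<bar>)"
  proof (rule sum.reindex_bij_witness[of _ "\<lambda>(i, \<alpha>). (\<tau> i, \<alpha>)" "\<lambda>(i, \<alpha>). (inv \<tau> i, \<alpha>)"])
  qed (use assms \<sigma>(1) in \<open>auto simp: permute_rows_def bij_is_inj bij_is_surj surj_f_inv_f o_inv_distrib\<close>)
  finally show ?thesis using \<sigma>(2) by simp
qed

lemma row_invariant_orbit_dist:
  fixes M :: "('n::finite, 'r::finite) matrix"
  shows "row_invariant (\<lambda>Z. orbit_dist Z M)"
  unfolding row_invariant_def
proof (intro allI impI antisym)
  fix \<tau> :: "'n \<Rightarrow> 'n" and Z :: "('n, 'r) matrix" assume \<tau>: "bij \<tau>"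
  show "orbit_dist (permute_rows \<tau> Z) M \<le> orbit_dist Z M" by (rule orbit_dist_permute_le[OF \<tau>])
  have "permute_rows (inv \<tau>) (permute_rows \<tau> Z) = Z"
    using \<tau> by (auto simp: permute_rows_def fun_eq_iff inv_inv_eq bij_is_inj)
  then show "orbit_dist Z M \<le> orbit_dist (permute_rows \<tau> Z) M"
    using orbit_dist_permute_le[OF bij_imp_bij_inv[OF \<tau>], of "permute_rows \<tau> Z" M] by simp
qed

lemma span_orbit_dist:
  assumes "\<And>p. (\<lambda>x. Z x p) \<in> semifield_span B" "\<And>p. (\<lambda>x. M x p) \<in> semifield_span B"
  shows "(\<lambda>x. orbit_dist (Z x) (M x)) \<in> semifield_span B"
  unfolding orbit_dist_def permute_rows_def case_prod_beta
  using permutations_nonempty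
  by (intro span_Min span_sum span_abs span_minus assms) auto

text \<open>
  The distance to the orbit of \<open>M\<close> is an invariant tropical rational function, hence a function of
  the basic values, and it tells the points of this orbit from all others.
\<close>
lemma generates_imp_separates:
  fixes F :: "('r::finite \<Rightarrow> nat) set"
  assumes "generates_invariants TYPE('n::finite) F"
  shows "separates_orbits TYPE('n) F"
  unfolding separates_orbits_def
proof (intro allI impI)
  fix M M' :: "('n, 'r) matrix" assume eq: "basic_map F M = basic_map F M'"
  have "tropical_rational UNIV (\<lambda>Z. orbit_dist Z M)"
    unfolding tropical_rational_iff_span[OF finite_class.finite_UNIV]
    by (intro span_orbit_dist semifield_span.base) (auto simp: coordinates_def)
  then obtain g where "(\<lambda>Z. orbit_dist Z M) = g \<circ> basic_map F"
    using assms row_invariant_orbit_dist[of M] unfolding generates_invariants_def by blast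
  then have "orbit_dist Z M = g (basic_map F Z)" for Z by (simp add: fun_eq_iff)
  then have "orbit_dist M' M = orbit_dist M M" using eq by simp
  moreover have "same_orbit M M"
    unfolding same_orbit_def
    by (intro exI[of _ id]) (auto simp: permute_rows_def fun_eq_iff)
  ultimately show "same_orbit M M'" by (simp add: orbit_dist_eq_0_iff[symmetric])
qed

section \<open>Basic values\<close>

lemma finite_basic_indices: "finite (basic_indices TYPE('n::finite) :: ('r::finite \<Rightarrow> nat) set)"
proof (rule finite_subset)
  show "basic_indices TYPE('n) \<subseteq> (PiE UNIV (\<lambda>_. {..CARD('n)}) :: ('r \<Rightarrow> nat) set)"
  proof
    fix c :: "'r \<Rightarrow> nat" assume "c \<in> basic_indices TYPE('n)"
    moreover have "c \<alpha> \<le> (\<Sum>\<beta>\<in>UNIV. c \<beta>)" for \<alpha> by (intro member_le_sum) auto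
    ultimately show "c \<in> PiE UNIV (\<lambda>_. {..CARD('n)})"
      by (auto simp: basic_indices_def intro: order_trans)
  qed
qed (intro finite_PiE, auto)

text \<open>
  This makes the maximum that defines a basic value range over a nonempty set.
\<close>
lemma ex_disjoint_family_with_cards:
  fixes U :: "'n set" and c :: "'r \<Rightarrow> nat"
  assumes "finite S" "finite U" "(\<Sum>\<alpha>\<in>S. c \<alpha>) \<le> card U"
  shows "\<exists>I. disjoint_family_on I S \<and> (\<forall>\<alpha>\<in>S. I \<alpha> \<subseteq> U \<and> card (I \<alpha>) = c \<alpha>)"
  using assms
proof (induction S arbitrary: U rule: finite_induct)
  case (insert \<beta> S)
  have "c \<beta> \<le> card U" using insert.prems insert.hyps by simp
  then obtain T where T: "T \<subseteq> U" "card T = c \<beta>"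
    using obtain_subset_with_card_n by metis
  have "finite T" using T insert.prems finite_subset by blast
  then have "(\<Sum>\<alpha>\<in>S. c \<alpha>) \<le> card (U - T)"
    using insert.prems insert.hyps T by (simp add: card_Diff_subset)
  then obtain I where I: "disjoint_family_on I S"
      "\<forall>\<alpha>\<in>S. I \<alpha> \<subseteq> U - T \<and> card (I \<alpha>) = c \<alpha>"
    using insert.IH[of "U - T"] insert.prems by blast
  show ?case
  proof (intro exI[of _ "I(\<beta> := T)"] conjI)
    have "disjoint_family_on (I(\<beta> := T)) S"
      using I(1) insert.hyps unfolding disjoint_family_on_def by (metis fun_upd_other)
    moreover have "T \<inter> (\<Union>\<alpha>\<in>S. (I(\<beta> := T)) \<alpha>) = {}"
    proof -
      have "(\<Union>\<alpha>\<in>S. (I(\<beta> := T)) \<alpha>) = (\<Union>\<alpha>\<in>S. I \<alpha>)"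
        using insert.hyps by (intro SUP_cong) auto
      then show ?thesis using I(2) by blast
    qed
    ultimately show "disjoint_family_on (I(\<beta> := T)) (insert \<beta> S)"
      using insert.hyps by (simp add: disjoint_family_on_insert)
    show "\<forall>\<alpha>\<in>insert \<beta> S. (I(\<beta> := T)) \<alpha> \<subseteq> U \<and> card ((I(\<beta> := T)) \<alpha>) = c \<alpha>"
      using I T by auto
  qed
qed (simp add: disjoint_family_on_def)

lemma basic_value_eq_Max_image:
  "basic_value c M = Max ((\<lambda>I. \<Sum>\<alpha>\<in>UNIV. \<Sum>i\<in>I \<alpha>. M (i, \<alpha>)) `
     {I. disjoint_family I \<and> (\<forall>\<alpha>. card (I \<alpha>) = c \<alpha>)})"
  unfolding basic_value_def by (simp only: setcompr_eq_image)

lemma span_basic_value: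
  fixes M :: "'x \<Rightarrow> ('n::finite, 'r::finite) matrix"
  assumes "c \<in> basic_indices TYPE('n)" "\<And>p. (\<lambda>x. M x p) \<in> semifield_span B"
  shows "(\<lambda>x. basic_value c (M x)) \<in> semifield_span B"
proof -
  have "{I :: 'r \<Rightarrow> 'n set. disjoint_family I \<and> (\<forall>\<alpha>. card (I \<alpha>) = c \<alpha>)} \<noteq> {}"
    using ex_disjoint_family_with_cards[of UNIV "UNIV :: 'n set" c] assms(1)
    by (auto simp: basic_indices_def)
  then show ?thesis
    unfolding basic_value_eq_Max_image by (intro span_Max span_sum assms) auto
qed

text \<open>
  The inverse of an injective map on orbits is Lipschitz because the basic values and the orbit
  distance are homogeneous piecewise linear: as functions of the pair \<open>(Z, W)\<close> both sides lie in the
  span of the entries, so the error bound for such functions applies.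
\<close>
lemma separates_imp_orbit_dist_le:
  fixes F :: "('r::finite \<Rightarrow> nat) set"
  assumes "F \<subseteq> basic_indices TYPE('n::finite)" "separates_orbits TYPE('n) F"
  shows "\<exists>C\<ge>0. \<forall>Z W :: ('n, 'r) matrix.
    orbit_dist Z W \<le> C * (\<Sum>c\<in>F. \<bar>basic_value c Z - basic_value c W\<bar>)"
proof -
  define E where "E v = (\<Sum>c\<in>F. \<bar>basic_value c (vec_nth (fst v)) - basic_value c (vec_nth (snd v))\<bar>)"
    for v :: "(real ^ ('n \<times> 'r)) \<times> (real ^ ('n \<times> 'r))"
  define D where "D v = orbit_dist (vec_nth (fst v)) (vec_nth (snd v))"
    for v :: "(real ^ ('n \<times> 'r)) \<times> (real ^ ('n \<times> 'r))"
  have entries: "(\<lambda>v :: (real ^ ('n \<times> 'r)) \<times> (real ^ ('n \<times> 'r)). fst v $ p) \<in> semifield_span {l. linear l}"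
    "(\<lambda>v :: (real ^ ('n \<times> 'r)) \<times> (real ^ ('n \<times> 'r)). snd v $ p) \<in> semifield_span {l. linear l}" for p
    by (auto intro!: semifield_span.base linearI)
  have "finite F" using assms(1) finite_basic_indices finite_subset by blast
  have "\<exists>C\<ge>0. \<forall>v. D v \<le> C * E v"
  proof (rule piecewise_linear_error_bound)
    show "D \<in> semifield_span {l. linear l}"
      unfolding D_def by (intro span_orbit_dist entries)
    show "E \<in> semifield_span {l. linear l}"
      unfolding E_def using assms(1)
      by (intro span_sum span_abs span_minus span_basic_value entries) auto
    show "0 \<le> E v" for v by (simp add: E_def sum_nonneg)
    show "D v \<le> 0" if "E v = 0" for v
    proof -
      have "basic_map F (vec_nth (snd v)) = basic_map F (vec_nth (fst v))"
        using that \<open>finite F\<close>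
        by (auto simp: E_def basic_map_def sum_nonneg_eq_0_iff intro!: restrict_ext)
      then have "same_orbit (vec_nth (snd v)) (vec_nth (fst v))"
        using assms(2) unfolding separates_orbits_def by blast
      then show ?thesis by (simp add: D_def orbit_dist_eq_0_iff[symmetric])
    qed
  qed
  then obtain C where C: "C \<ge> 0" "\<And>v. D v \<le> C * E v" by blast
  have "orbit_dist Z W \<le> C * (\<Sum>c\<in>F. \<bar>basic_value c Z - basic_value c W\<bar>)"
    for Z W :: "('n, 'r) matrix"
    using C(2)[of "(vec_lambda Z, vec_lambda W)"] by (simp add: D_def E_def vec_lambda_inverse)
  then show ?thesis using C(1) by blast
qed

section \<open>Recovering a matrix from its single-column values\<close>

text \<open>
  Subtracting the threshold \<open>t\<close> from \<open>v\<close> changes both sums equally, because the two sets have the same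
  size. Afterwards \<open>T\<close> collects all positive terms and no negative ones.
\<close>
lemma sum_le_sum_threshold_set:
  fixes v :: "'n::finite \<Rightarrow> real"
  assumes "card S = card T" "\<And>j. j \<in> T \<Longrightarrow> t \<le> v j" "\<And>j. j \<notin> T \<Longrightarrow> v j \<le> t"
  shows "(\<Sum>j\<in>S. v j) \<le> (\<Sum>j\<in>T. v j)"
proof -
  have "(\<Sum>j\<in>S. v j - t) = (\<Sum>j\<in>S \<inter> T. v j - t) + (\<Sum>j\<in>S - T. v j - t)"
    by (simp add: sum.Int_Diff[of S _ T])
  also have "\<dots> \<le> (\<Sum>j\<in>S \<inter> T. v j - t) + 0"
    using assms(3) by (intro add_left_mono sum_nonpos) auto
  also have "\<dots> \<le> (\<Sum>j\<in>T. v j - t)"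
    using assms(2) by (auto intro!: sum_mono2)
  finally show ?thesis using assms(1) by (simp add: sum_subtractf)
qed

lemma basic_value_single_column:
  fixes M :: "('n::finite, 'r::finite) matrix"
  assumes "card T = k" "\<And>j. j \<in> T \<Longrightarrow> t \<le> M (j, \<alpha>)" "\<And>j. j \<notin> T \<Longrightarrow> M (j, \<alpha>) \<le> t"
  shows "basic_value (\<lambda>\<beta>. k * std_basis \<alpha> \<beta>) M = (\<Sum>j\<in>T. M (j, \<alpha>))"
  unfolding basic_value_eq_Max_image
proof (rule Max_eqI)
  have collapse: "(\<Sum>\<beta>\<in>UNIV. \<Sum>i\<in>I \<beta>. M (i, \<beta>)) = (\<Sum>i\<in>I \<alpha>. M (i, \<alpha>))"
    if "\<And>\<beta>. \<beta> \<noteq> \<alpha> \<Longrightarrow> I \<beta> = {}" for I :: "'r \<Rightarrow> 'n set"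
    using that by (subst sum.remove[of _ \<alpha>]) (auto intro!: sum.neutral)
  let ?\<I> = "{I :: 'r \<Rightarrow> 'n set. disjoint_family I \<and> (\<forall>\<beta>. card (I \<beta>) = k * std_basis \<alpha> \<beta>)}"
  fix y assume "y \<in> (\<lambda>I. \<Sum>\<alpha>\<in>UNIV. \<Sum>i\<in>I \<alpha>. M (i, \<alpha>)) ` ?\<I>"
  then obtain I where I: "y = (\<Sum>\<beta>\<in>UNIV. \<Sum>i\<in>I \<beta>. M (i, \<beta>))"
    "\<And>\<beta>. card (I \<beta>) = k * std_basis \<alpha> \<beta>" by auto
  have "I \<beta> = {}" if "\<beta> \<noteq> \<alpha>" for \<beta> using I(2)[of \<beta>] that by (simp add: std_basis_def)
  then have "y = (\<Sum>i\<in>I \<alpha>. M (i, \<alpha>))" using I(1) collapse by simp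
  also have "\<dots> \<le> (\<Sum>j\<in>T. M (j, \<alpha>))"
    using I(2)[of \<alpha>] assms by (intro sum_le_sum_threshold_set[where t = t]) (auto simp: std_basis_def)
  finally show "y \<le> (\<Sum>j\<in>T. M (j, \<alpha>))" .
next
  let ?I = "\<lambda>\<beta>. if \<beta> = \<alpha> then T else {}"
  show "(\<Sum>j\<in>T. M (j, \<alpha>)) \<in> (\<lambda>I. \<Sum>\<alpha>\<in>UNIV. \<Sum>i\<in>I \<alpha>. M (i, \<alpha>)) `
      {I :: 'r \<Rightarrow> 'n set. disjoint_family I \<and> (\<forall>\<beta>. card (I \<beta>) = k * std_basis \<alpha> \<beta>)}"
  proof (rule image_eqI[of _ _ ?I])
    show "(\<Sum>j\<in>T. M (j, \<alpha>)) = (\<Sum>\<beta>\<in>UNIV. \<Sum>i\<in>?I \<beta>. M (i, \<beta>))"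
      by (subst sum.remove[of _ \<alpha>]) (auto intro!: sum.neutral)
    show "?I \<in> {I. disjoint_family I \<and> (\<forall>\<beta>. card (I \<beta>) = k * std_basis \<alpha> \<beta>)}"
      using assms(1) by (auto simp: disjoint_family_on_def std_basis_def)
  qed
qed auto

text \<open>
  Here \<open>\<tau> (i, \<alpha>)\<close> is the number of entries of column \<open>\<alpha>\<close> that precede entry \<open>i\<close> in decreasing order.
  The case distinction supplies the empty sum for rank \<open>0\<close>: the index \<open>0\<close> belongs to no basic value.
\<close>
definition matrix_from_ranks ::
  "('n \<times> 'r \<Rightarrow> nat) \<Rightarrow> (('r \<Rightarrow> nat) \<Rightarrow> real) \<Rightarrow> ('n, 'r) matrix" where
  "matrix_from_ranks \<tau> y = (\<lambda>(i, \<alpha>). y (\<lambda>\<beta>. Suc (\<tau> (i, \<alpha>)) * std_basis \<alpha> \<beta>) -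
     (if \<tau> (i, \<alpha>) = 0 then 0 else y (\<lambda>\<beta>. \<tau> (i, \<alpha>) * std_basis \<alpha> \<beta>)))"

lemma single_column_index_in:
  assumes "single_column_indices TYPE('n::finite) \<subseteq> F" "0 < k" "k \<le> CARD('n)"
  shows "(\<lambda>\<beta>. k * std_basis \<alpha> \<beta>) \<in> F"
  using assms unfolding single_column_indices_def by force

text \<open>
  As the rank of an entry one can take the number of strictly larger entries in its column. Ties
  then share a rank, which does no harm: both the set of strictly larger entries and this set
  together with the entry itself are cut out by the value of the entry as threshold, so their sums
  are consecutive single-column values and their difference is the entry.
\<close>
lemma matrix_recovered_from_ranks:
  fixes M :: "('n::finite, 'r::finite) matrix"
  assumes F: "single_column_indices TYPE('n) \<subseteq> F"
  shows "\<exists>\<tau>. (\<forall>p. \<tau> p < CARD('n)) \<and> matrix_from_ranks \<tau> (basic_map F M) = M"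
proof -
  define T where "T p = {j. M p < M (j, snd p)}" for p :: "'n \<times> 'r"
  define \<tau> where "\<tau> p = card (T p)" for p
  have less: "\<tau> p < CARD('n)" for p
  proof -
    have "fst p \<notin> T p" by (simp add: T_def)
    then have "T p \<subset> UNIV" by blast
    then show ?thesis unfolding \<tau>_def by (intro psubset_card_mono) auto
  qed
  have "matrix_from_ranks \<tau> (basic_map F M) (i, \<alpha>) = M (i, \<alpha>)" for i \<alpha>
  proof -
    let ?k = "\<tau> (i, \<alpha>)"
    have i: "i \<notin> T (i, \<alpha>)" by (simp add: T_def)
    have lower: "basic_value (\<lambda>\<beta>. ?k * std_basis \<alpha> \<beta>) M = (\<Sum>j\<in>T (i, \<alpha>). M (j, \<alpha>))"
      by (rule basic_value_single_column[where t = "M (i, \<alpha>)"]) (auto simp: \<tau>_def T_def)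
    have upper: "basic_value (\<lambda>\<beta>. Suc ?k * std_basis \<alpha> \<beta>) M =
        (\<Sum>j\<in>insert i (T (i, \<alpha>)). M (j, \<alpha>))"
      using i by (intro basic_value_single_column[where t = "M (i, \<alpha>)"]) (auto simp: \<tau>_def T_def)
    have "(\<Sum>j\<in>T (i, \<alpha>). M (j, \<alpha>)) = 0" if "?k = 0" using that by (simp add: \<tau>_def)
    moreover have "(\<lambda>\<beta>. Suc ?k * std_basis \<alpha> \<beta>) \<in> F"
      using less[of "(i, \<alpha>)"] by (intro single_column_index_in[OF F]) auto
    moreover have "(\<lambda>\<beta>. ?k * std_basis \<alpha> \<beta>) \<in> F" if "?k \<noteq> 0"
      using less[of "(i, \<alpha>)"] that by (intro single_column_index_in[OF F]) auto
    ultimately show ?thesis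
      using lower upper i by (simp add: matrix_from_ranks_def basic_map_def del: mult_Suc)
  qed
  then show ?thesis using less by (intro exI[of _ \<tau>]) auto
qed

lemma span_matrix_from_ranks:
  fixes F :: "('r::finite \<Rightarrow> nat) set" and \<tau> :: "'n::finite \<times> 'r \<Rightarrow> nat"
  assumes F: "single_column_indices TYPE('n) \<subseteq> F" and \<tau>: "\<And>p. \<tau> p < CARD('n)"
  shows "(\<lambda>y. matrix_from_ranks \<tau> y p) \<in> semifield_span (range (\<lambda>\<gamma> _. \<gamma>) \<union> coordinates F)"
proof -
  have y: "(\<lambda>y. y (\<lambda>\<beta>. k * std_basis \<alpha> \<beta>)) \<in> semifield_span (range (\<lambda>\<gamma> _. \<gamma>) \<union> coordinates F)"
    if "0 < k" "k \<le> CARD('n)" for k \<alpha>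
    using single_column_index_in[OF F that]
    by (intro semifield_span.base) (auto simp: coordinates_def)
  obtain i \<alpha> where p: "p = (i, \<alpha>)" by force
  show ?thesis
    using \<tau>[of p] unfolding matrix_from_ranks_def p prod.case
    by (cases "\<tau> (i, \<alpha>) = 0")
      (auto simp del: mult_Suc intro!: span_minus y semifield_span.zero)
qed

section \<open>Separating subfamilies generate\<close>

text \<open>
  The function \<open>g\<close> minimises over all tables of ranks. Its penalty factor \<open>K\<close> has to be a natural
  number, since tropical rational functions have integral slopes.
\<close>
lemma separates_imp_generates:
  fixes F :: "('r::finite \<Rightarrow> nat) set"
  assumes F: "F \<subseteq> basic_indices TYPE('n::finite)" and col: "single_column_indices TYPE('n) \<subseteq> F"
    and sep: "separates_orbits TYPE('n) F"
  shows "generates_invariants TYPE('n) F"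
  unfolding generates_invariants_def
proof (intro allI impI)
  fix f :: "('n, 'r) matrix \<Rightarrow> real"
  assume "tropical_rational UNIV f \<and> row_invariant f"
  then have f: "f \<in> semifield_span (range (\<lambda>\<gamma> _. \<gamma>) \<union> coordinates UNIV)"
    and inv: "row_invariant f" by (simp_all add: tropical_rational_iff_span)
  have "finite F" using F finite_basic_indices finite_subset by blast
  obtain L where L: "L \<ge> 0" "\<And>x y. \<bar>f x - f y\<bar> \<le> L * (\<Sum>p\<in>UNIV. \<bar>x p - y p\<bar>)"
    using span_affine_coordinates_Lipschitz[OF f] by blast
  obtain C where C: "C \<ge> 0" "\<And>Z W :: ('n, 'r) matrix.
      orbit_dist Z W \<le> C * (\<Sum>c\<in>F. \<bar>basic_value c Z - basic_value c W\<bar>)"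
    using separates_imp_orbit_dist_le[OF F sep] by blast
  obtain K :: nat where K: "L * C \<le> real K" using real_arch_simple by blast
  have bound: "f Z \<le> f W + real K * (\<Sum>c\<in>F. \<bar>basic_value c W - basic_value c Z\<bar>)" for Z W
  proof -
    obtain \<sigma> where \<sigma>: "bij \<sigma>" "orbit_dist Z W = (\<Sum>p\<in>UNIV. \<bar>Z p - permute_rows \<sigma> W p\<bar>)"
      by (rule orbit_dist_attained)
    have "f Z - f W = f Z - f (permute_rows \<sigma> W)"
      using inv \<sigma>(1) by (simp add: row_invariant_def)
    also have "\<dots> \<le> L * orbit_dist Z W" using L(2)[of Z "permute_rows \<sigma> W"] \<sigma>(2) by simp
    also have "\<dots> \<le> L * (C * (\<Sum>c\<in>F. \<bar>basic_value c Z - basic_value c W\<bar>))"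
      by (intro mult_left_mono C L)
    also have "\<dots> \<le> real K * (\<Sum>c\<in>F. \<bar>basic_value c Z - basic_value c W\<bar>)"
      unfolding mult.assoc[symmetric] by (intro mult_right_mono K sum_nonneg) auto
    finally show ?thesis by (simp add: abs_minus_commute)
  qed
  define ranks :: "('n \<times> 'r \<Rightarrow> nat) set" where "ranks = {\<tau>. \<forall>p. \<tau> p < CARD('n)}"
  have "ranks = PiE UNIV (\<lambda>_. {..<CARD('n)})" by (auto simp: ranks_def)
  then have ranks: "finite ranks" by (simp add: finite_PiE)
  have "(\<lambda>_. 0) \<in> ranks" by (simp add: ranks_def)
  define h where "h \<tau> y = f (matrix_from_ranks \<tau> y) +
      real K * (\<Sum>c\<in>F. \<bar>basic_value c (matrix_from_ranks \<tau> y) - y c\<bar>)" for \<tau> y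
  define g where "g y = Min ((\<lambda>\<tau>. h \<tau> y) ` ranks)" for y
  have "tropical_rational F g"
  proof -
    let ?B = "range (\<lambda>\<gamma> _. \<gamma>) \<union> coordinates F"
    have "h \<tau> \<in> semifield_span ?B" if "\<tau> \<in> ranks" for \<tau>
    proof -
      have entry: "(\<lambda>y. matrix_from_ranks \<tau> y p) \<in> semifield_span ?B" for p
        using that unfolding ranks_def by (intro span_matrix_from_ranks col) blast
      have "(\<lambda>y. f (matrix_from_ranks \<tau> y)) \<in> semifield_span ?B"
        by (rule span_substitute[OF f])
          (auto simp: coordinates_def entry[unfolded coordinates_def] intro: semifield_span.base)
      moreover have "(\<lambda>y. y c) \<in> semifield_span ?B" if "c \<in> F" for c
        using that by (intro semifield_span.base) (auto simp: coordinates_def)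
      ultimately show ?thesis
        unfolding h_def using F
        by (intro semifield_span.plus span_of_nat_mult span_sum span_abs span_minus
            span_basic_value entry) auto
    qed
    then have "g \<in> semifield_span ?B"
      unfolding g_def using \<open>(\<lambda>_. 0) \<in> ranks\<close> by (intro span_Min ranks) auto
    then show ?thesis by (simp add: tropical_rational_iff_span \<open>finite F\<close>)
  qed
  moreover have "f M = g (basic_map F M)" for M
  proof -
    obtain \<tau> where \<tau>: "\<tau> \<in> ranks" "matrix_from_ranks \<tau> (basic_map F M) = M"
      using matrix_recovered_from_ranks[OF col, of M] by (auto simp: ranks_def)
    have "g (basic_map F M) = f M"
      unfolding g_def
    proof (rule Min_eqI)
      show "finite ((\<lambda>\<tau>. h \<tau> (basic_map F M)) ` ranks)" using ranks by simp
      have "h \<tau> (basic_map F M) = f M"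
        using \<tau>(2) by (simp add: h_def basic_map_def)
      then show "f M \<in> (\<lambda>\<tau>. h \<tau> (basic_map F M)) ` ranks" using \<tau>(1) by force
      show "f M \<le> y" if y_in: "y \<in> (\<lambda>\<tau>. h \<tau> (basic_map F M)) ` ranks" for y
      proof -
        obtain \<rho> where y: "y = h \<rho> (basic_map F M)" using y_in by blast
        have "y = f (matrix_from_ranks \<rho> (basic_map F M)) + real K *
            (\<Sum>c\<in>F. \<bar>basic_value c (matrix_from_ranks \<rho> (basic_map F M)) - basic_value c M\<bar>)"
          unfolding y h_def by (simp add: basic_map_def)
        then show ?thesis using bound by simp
      qed
    qed
    then show ?thesis by simp
  qed
  ultimately show "\<exists>g. tropical_rational F g \<and> f = g \<circ> basic_map F"
    by (intro exI[of _ g]) (auto simp: fun_eq_iff)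
qed

theorem corollary3p9:
  fixes F :: "('r::finite \<Rightarrow> nat) set"
  assumes "F \<subseteq> basic_indices TYPE('n::finite)"
  shows "(generates_invariants TYPE('n) F \<longrightarrow> separates_orbits TYPE('n) F) \<and>
         (single_column_indices TYPE('n) \<subseteq> F \<and> separates_orbits TYPE('n) F
            \<longrightarrow> generates_invariants TYPE('n) F) \<and>
         (single_column_indices TYPE('n) \<subseteq> F
            \<longrightarrow> (generates_invariants TYPE('n) F \<longleftrightarrow> separates_orbits TYPE('n) F))"
  using generates_imp_separates separates_imp_generates[OF assms] by blast

end
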